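(* Let $G$ be a nonabelian group, and let $\rho_1,\rho_2\colon G\to \mathrm{Homeo}(\mathbb{R})$ be two actions of $G$ on $\mathbb{R}$, each of which is minimal and hyperbolic-like. Suppose that for every $g\in G$, $\rho_1(g)$ has a fixed point in $\mathbb{R}$ if and only if $\rho_2(g)$ has a fixed point in $\mathbb{R}$. Then $\rho_1$ and $\rho_2$ are conjugate: there is a homeomorphism $\Theta\colon\mathbb{R}\to\mathbb{R}$ such that $\Theta\circ\rho_1(g)=\rho_2(g)\circ\Theta$ for all $g\in G$.
   Context: An action of a group $G$ on $\mathbb{R}$ by homeomorphisms is \emph{hyperbolic-like} if every element of $G$ acts by a homeomorphism commuting with integer translations (in particular orientation-preserving), and each nontrivial element of $G$ either acts without fixed points or has exactly two fixed points in $[0,1)$, one attracting and one repelling. (In particular, a hyperbolic-like action is faithful.) An action is \emph{minimal} if all its orbits are dense in $\mathbb{R}$. *)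

theory Defs
  imports "HOL-Analysis.Analysis" "HOL-Algebra.Group_Action"
begin

(* The library's group actions are homomorphisms into the group of bijections of the
   underlying set; on UNIV the extensionality built into that group is vacuous. *)
definition acts_by_homeos_on_line :: "('g, 'm) monoid_scheme \<Rightarrow> ('g \<Rightarrow> real \<Rightarrow> real) \<Rightarrow> bool"
  where "acts_by_homeos_on_line G \<rho> \<longleftrightarrow>
    group_action G UNIV \<rho> \<and>
    (\<forall>g\<in>carrier G. homeomorphism UNIV UNIV (\<rho> g) (inv_into UNIV (\<rho> g)))"

definition commutes_with_int_translations :: "(real \<Rightarrow> real) \<Rightarrow> bool"
  where "commutes_with_int_translations f \<longleftrightarrow>
    (\<forall>x. \<forall>n::int. f (x + of_int n) = f x + of_int n)"

definition attracting_fixpoint :: "(real \<Rightarrow> real) \<Rightarrow> real \<Rightarrow> bool"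
  where "attracting_fixpoint f p \<longleftrightarrow>
    f p = p \<and> (\<exists>U. open U \<and> p \<in> U \<and> (\<forall>x\<in>U. (\<lambda>n. (f ^^ n) x) \<longlonglongrightarrow> p))"

(* Only meaningful for bijective f. *)
definition repelling_fixpoint :: "(real \<Rightarrow> real) \<Rightarrow> real \<Rightarrow> bool"
  where "repelling_fixpoint f p \<longleftrightarrow> attracting_fixpoint (inv_into UNIV f) p"

(* The identity has infinitely many fixed points in [0,1), so the second clause forces
   the action to be faithful. *)
definition hyperbolic_like :: "('g, 'm) monoid_scheme \<Rightarrow> ('g \<Rightarrow> real \<Rightarrow> real) \<Rightarrow> bool"
  where "hyperbolic_like G \<rho> \<longleftrightarrow>
    acts_by_homeos_on_line G \<rho> \<and>
    (\<forall>g\<in>carrier G. commutes_with_int_translations (\<rho> g)) \<and>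
    (\<forall>g\<in>carrier G. g \<noteq> \<one>\<^bsub>G\<^esub> \<longrightarrow>
      (\<forall>x. \<rho> g x \<noteq> x) \<or>
      (\<exists>a r. a \<noteq> r \<and> {x \<in> {0..<1}. \<rho> g x = x} = {a, r} \<and>
             attracting_fixpoint (\<rho> g) a \<and> repelling_fixpoint (\<rho> g) r))"

definition minimal_action :: "('g, 'm) monoid_scheme \<Rightarrow> ('g \<Rightarrow> real \<Rightarrow> real) \<Rightarrow> bool"
  where "minimal_action G \<rho> \<longleftrightarrow> (\<forall>x. closure (orbit G \<rho> x) = UNIV)"

end

theory Submission
  imports Defs
begin

text \<open>The idea is to recover the action from two pieces of information about the elements of the group:
  which of them fix a point of the line, and in which direction the others move the line. (An element
  without fixed points moves all points up or all points down.) The first piece is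
  common to both actions by assumption. The second turns out to be common to both after a
  reflection of the line, if necessary.

  The starting point is a nontrivial element \<open>g\<close> with a fixed point. It exists because a minimal
  action in which no nontrivial element fixes a point forces the group to be abelian, by Hoelder's
  theorem (\<open>free_imp_comm_group\<close>). Let \<open>a\<close> be an attracting fixed point of \<open>g\<close>, and \<open>r < a < r + 1\<close> the
  repelling fixed points next to it. Then a product \<open>q g\<^sup>m\<close> with \<open>m\<close> large
  maps most of the interval from \<open>r\<close> to \<open>r + 1\<close> close to \<open>q a\<close>. It has a fixed point if \<open>q a\<close> is
  inside this interval, and it moves all points up if \<open>q a\<close> is to the right of it and \<open>q\<close> moves \<open>r\<close>
  up. Since the orbit of \<open>r + 1\<close> is dense, it follows that \<open>a < k a\<close> holds if and only if there
  is some \<open>q\<close> such that, for all large \<open>m\<close>, the element \<open>q g\<^sup>m\<close> fixes a point and \<open>q k g\<^sup>m\<close> moves up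
  (\<open>moves_attractor_right_iff\<close>). This criterion uses only the two pieces of information above.
  So the orbits of the attracting points of \<open>g\<close> under the two actions are isomorphic as ordered
  \<open>G\<close>-sets, and, being dense, they determine a conjugacy (\<open>conjugate_if_orbits_order_isomorphic\<close>).

  It remains to compare directions (\<open>not_down_if_up\<close>). Suppose that \<open>k\<close> moves up in both actions,
  whereas \<open>u\<close> moves up in the first and down in the second. In the second action every
  product of conjugates of \<open>k\<close> and of the inverse of \<open>u\<close> moves up, so no such product fixes a point
  in either action. In the first action this means that the graphs of powers of conjugates of \<open>k\<close> do
  not cross those of conjugates of \<open>u\<close>. For a \<open>k\<close> whose graph crosses that of the
  translation by \<open>1\<close>, this is impossible: conjugation by a high power of \<open>g\<close> turns \<open>u\<close> into almost
  a staircase with steps of height and length \<open>1\<close>, which some power of a conjugate of \<open>k\<close> crosses;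
  the only exception is a translation \<open>u\<close>, which is crossed by a power of \<open>k\<close> itself.\<close>

section \<open>Lifts of circle homeomorphisms\<close>

definition circle_lift :: "(real \<Rightarrow> real) \<Rightarrow> bool"
  where "circle_lift s \<longleftrightarrow>
    strict_mono s \<and> continuous_on UNIV s \<and> commutes_with_int_translations s"

definition moves_up :: "(real \<Rightarrow> real) \<Rightarrow> bool"
  where "moves_up s \<longleftrightarrow> (\<forall>x. x < s x)"

text \<open>A hyperbolic lift \<open>f\<close> is used only through one basin of attraction: an attracting fixed
  point \<open>a\<close> together with the repelling fixed points \<open>r\<close> and \<open>r + 1\<close> next to it.
  By periodicity \<open>(r + i, r + i + 1)\<close> is then the basin of \<open>a + i\<close>.\<close>

definition basin :: "(real \<Rightarrow> real) \<Rightarrow> real \<Rightarrow> real \<Rightarrow> bool"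
  where "basin f r a \<longleftrightarrow> circle_lift f \<and> r < a \<and> a < r + 1 \<and> f r = r \<and> f a = a \<and>
    (\<forall>x. r < x \<longrightarrow> x < r + 1 \<longrightarrow> (\<lambda>m. (f ^^ m) x) \<longlonglongrightarrow> a)"

lemma circle_lift_less_iff: "circle_lift s \<Longrightarrow> s x < s y \<longleftrightarrow> x < y"
  by (simp add: circle_lift_def strict_mono_less)

lemma circle_lift_le_iff: "circle_lift s \<Longrightarrow> s x \<le> s y \<longleftrightarrow> x \<le> y"
  by (simp add: circle_lift_def strict_mono_less_eq)

lemma circle_lift_add_int: "circle_lift s \<Longrightarrow> s (x + of_int n) = s x + of_int n"
  by (simp add: circle_lift_def commutes_with_int_translations_def)

lemma circle_lift_add_1: "circle_lift s \<Longrightarrow> s (x + 1) = s x + 1"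
  using circle_lift_add_int[of s x 1] by simp

lemma circle_lift_diff_1: "circle_lift s \<Longrightarrow> s (x - 1) = s x - 1"
  using circle_lift_add_int[of s x "-1"] by simp

lemma circle_lift_isCont: "circle_lift s \<Longrightarrow> isCont s x"
  by (simp add: circle_lift_def continuous_on_eq_continuous_at)

lemma circle_lift_comp: "circle_lift s \<Longrightarrow> circle_lift t \<Longrightarrow> circle_lift (\<lambda>x. s (t x))"
  unfolding circle_lift_def commutes_with_int_translations_def
  by (auto intro: strict_mono_compose[of s t, unfolded comp_def] continuous_on_compose2)

lemma circle_lift_translate: "circle_lift s \<Longrightarrow> circle_lift (\<lambda>x. s x + of_int n)"
  unfolding circle_lift_def commutes_with_int_translations_def strict_mono_def
  by (auto intro!: continuous_intros)

lemma circle_lift_funpow: "circle_lift s \<Longrightarrow> circle_lift (s ^^ m)"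
proof (induction m)
  case 0
  then show ?case
    by (simp add: circle_lift_def commutes_with_int_translations_def strict_mono_def id_def)
next
  case (Suc m)
  then show ?case using circle_lift_comp[of s "s ^^ m"] by (simp add: comp_def)
qed

lemma circle_lift_tendsto:
  "circle_lift s \<Longrightarrow> (X \<longlongrightarrow> l) F \<Longrightarrow> ((\<lambda>m. s (X m)) \<longlongrightarrow> s l) F"
  using circle_lift_isCont isCont_tendsto_compose by blast

lemma ex_int_translate_into_unit_interval: "\<exists>n::int. r \<le> x + of_int n \<and> x + of_int n < r + (1::real)"
  by (rule exI[of _ "- \<lfloor>x - r\<rfloor>"]) (simp, linarith)

lemma fixed_point_between:
  assumes s: "continuous_on UNIV s" and t: "continuous_on UNIV (t::real\<Rightarrow>real)"
    and "s x \<le> t x" "t y \<le> s y"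
  shows "\<exists>z. s z = t z"
proof -
  have "continuous_on {min x y..max x y} (\<lambda>z. s z - t z)"
    by (rule continuous_on_diff[OF continuous_on_subset[OF s] continuous_on_subset[OF t]]) simp_all
  then have "\<exists>z. s z - t z = 0"
    using IVT'[of "\<lambda>z. s z - t z" x 0 y] IVT2'[of "\<lambda>z. s z - t z" x 0 y] assms(3,4)
    by (cases "x \<le> y") (auto simp: min_def max_def)
  then show ?thesis by auto
qed

lemma moves_up_or_down:
  assumes "circle_lift s" "\<forall>x. s x \<noteq> x"
  shows "moves_up s \<or> (\<forall>x. s x < x)"
proof (rule ccontr)
  assume "\<not> ?thesis"
  then obtain x y where "s x \<le> x" "y \<le> s y" unfolding moves_up_def by (meson not_less)
  then show False
    using fixed_point_between[of s "\<lambda>x. x" x y] assms unfolding circle_lift_def by auto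
qed

lemma moves_up_funpow: "moves_up s \<Longrightarrow> moves_up (s ^^ Suc i)"
proof (induction i)
  case (Suc i)
  have "x < s ((s ^^ Suc i) x)" for x
    using Suc unfolding moves_up_def by (meson less_trans)
  then show ?case by (simp add: moves_up_def)
qed (simp add: moves_up_def)

text \<open>Comparing \<open>s\<close> with the unit translation at one point is enough to compare their powers there,
  because \<open>s\<close> commutes with that translation.\<close>

lemma funpow_less_shift:
  assumes s: "circle_lift s" and x: "s x < x + 1"
  shows "(s ^^ Suc i) x < x + real (Suc i)"
proof (induction i)
  case (Suc i)
  have "s ((s ^^ Suc i) x) < s (x + of_int (int (Suc i)))"
    using Suc s circle_lift_less_iff by fastforce
  also have "\<dots> = s x + real (Suc i)"
    by (subst circle_lift_add_int[OF s]) simp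
  finally show ?case using x by simp
qed (use x in simp)

lemma funpow_ge_shift:
  assumes s: "circle_lift s" and x: "x + 1 \<le> s x"
  shows "x + real i \<le> (s ^^ i) x"
proof (induction i)
  case (Suc i)
  have "s x + real i = s (x + of_int (int i))"
    by (subst circle_lift_add_int[OF s]) simp
  also have "\<dots> \<le> s ((s ^^ i) x)"
    using Suc s circle_lift_le_iff by fastforce
  finally show ?case using x by simp
qed simp

lemma basin_lift: "basin f r a \<Longrightarrow> circle_lift f"
  by (simp add: basin_def)

lemma basin_funpow_fixed: "basin f r a \<Longrightarrow> (f ^^ m) r = r \<and> (f ^^ m) a = a"
  by (induction m) (auto simp: basin_def)

lemma basin_tendsto:
  "basin f r a \<Longrightarrow> r < x \<Longrightarrow> x < r + 1 \<Longrightarrow> (\<lambda>m. (f ^^ m) x) \<longlonglongrightarrow> a"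
  by (simp add: basin_def)

lemma basin_tendsto_shift:
  assumes b: "basin f r a" and "r + of_int i < x" "x < r + of_int i + 1"
  shows "(\<lambda>m. (f ^^ m) x) \<longlonglongrightarrow> a + of_int i"
proof -
  have "(\<lambda>m. (f ^^ m) (x - of_int i) + of_int i) \<longlonglongrightarrow> a + of_int i"
    using assms by (intro tendsto_intros basin_tendsto[OF b]) auto
  moreover have "(f ^^ m) (x - of_int i) + of_int i = (f ^^ m) x" for m
    using circle_lift_add_int[OF circle_lift_funpow[OF basin_lift[OF b]], of m "x - of_int i" i] by simp
  ultimately show ?thesis by simp
qed

lemma moves_up_on_unit_interval:
  assumes "circle_lift s" "\<And>x. r \<le> x \<Longrightarrow> x < r + 1 \<Longrightarrow> x < s x"
  shows "moves_up s"
  unfolding moves_up_def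
proof
  fix x
  obtain n :: int where "r \<le> x + of_int n" "x + of_int n < r + 1"
    using ex_int_translate_into_unit_interval by blast
  then show "x < s x" using assms circle_lift_add_int by fastforce
qed

text \<open>For large \<open>m\<close> the map \<open>s \<circ> f ^^ m\<close> is nearly constant, with value \<open>s a\<close>, on the basin of \<open>a\<close>.
  If this value lies to the right of the basin, the points of the basin away from \<open>r\<close> move up;
  the points near \<open>r\<close>, where the approximation is bad, move up because \<open>r\<close> itself does.\<close>

lemma eventually_moves_up_past_basin:
  assumes b: "basin f r a" and s: "circle_lift s" and "r + 1 \<le> s a" and sr: "r < s r"
  shows "\<forall>\<^sub>F m in sequentially. moves_up (\<lambda>x. s ((f ^^ m) x))"
proof -
  obtain e where e: "r < e" "e < a" "e < s r"
    using b sr dense[of r "min a (s r)"] by (auto simp: basin_def)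
  have "(\<lambda>m. s ((f ^^ m) e)) \<longlonglongrightarrow> s a"
    by (rule circle_lift_tendsto[OF s basin_tendsto[OF b]]) (insert b e, simp_all add: basin_def)
  then have "\<forall>\<^sub>F m in sequentially. a < s ((f ^^ m) e)"
    using b assms(3) by (intro order_tendstoD) (auto simp: basin_def)
  then show ?thesis
  proof eventually_elim
    case (elim m)
    let ?h = "\<lambda>x. s ((f ^^ m) x)"
    have h: "circle_lift ?h"
      using s circle_lift_comp circle_lift_funpow basin_lift[OF b] by blast
    have ends: "?h r = s r" "?h a = s a" using basin_funpow_fixed[OF b] by auto
    show ?case
    proof (rule moves_up_on_unit_interval[OF h])
      fix x assume x: "r \<le> x" "x < r + 1"
      \<comment> \<open>When \<open>s a = r + 1\<close>, the estimate at \<open>e\<close> gives less than \<open>r + 1\<close>; monotonicity at \<open>a\<close> covers the rest.\<close>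
      consider "x \<le> e" | "e \<le> x" "x \<le> a" | "a \<le> x" by linarith
      then show "x < ?h x"
      proof cases
        case 1
        then show ?thesis using circle_lift_le_iff[OF h, of r x] x e ends by linarith
      next
        case 2
        then show ?thesis using circle_lift_le_iff[OF h, of e x] elim by linarith
      next
        case 3
        then show ?thesis using circle_lift_le_iff[OF h, of a x] x assms(3) ends by linarith
      qed
    qed
  qed
qed

text \<open>If the value \<open>s a\<close> lies inside the basin, the nearly constant map \<open>s \<circ> f ^^ m\<close> sends a compact
  interval around \<open>s a\<close> into itself.\<close>

lemma eventually_fixed_point_in_basin:
  assumes b: "basin f r a" and s: "circle_lift s" and sa: "r < s a" "s a < r + 1"
  shows "\<forall>\<^sub>F m in sequentially. \<exists>x. s ((f ^^ m) x) = x"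
proof -
  obtain c d where c: "r < c" "c < s a" and d: "s a < d" "d < r + 1"
    using sa dense by meson
  have "(\<lambda>m. s ((f ^^ m) c)) \<longlonglongrightarrow> s a" "(\<lambda>m. s ((f ^^ m) d)) \<longlonglongrightarrow> s a"
    by (rule circle_lift_tendsto[OF s basin_tendsto[OF b]]; insert sa c d, simp)+
  then have "\<forall>\<^sub>F m in sequentially. c < s ((f ^^ m) c)" "\<forall>\<^sub>F m in sequentially. s ((f ^^ m) d) < d"
    using c d order_tendstoD by blast+
  then show ?thesis
  proof eventually_elim
    case (elim m)
    have "circle_lift (\<lambda>x. s ((f ^^ m) x))"
      using s circle_lift_comp circle_lift_funpow basin_lift[OF b] by blast
    then show ?case
      using fixed_point_between[of "\<lambda>x. s ((f ^^ m) x)" "\<lambda>x. x" d c] elim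
      by (auto simp: circle_lift_def)
  qed
qed

lemma circle_lift_reflect:
  assumes "circle_lift s"
  shows "circle_lift (\<lambda>x. - s (- x))"
proof -
  have "continuous_on UNIV (\<lambda>x. - s (- x))"
    using assms by (intro continuous_intros)
      (auto simp: circle_lift_def intro!: continuous_intros intro: continuous_on_compose2[of UNIV s])
  moreover have "s (- x - of_int n) = s (- x) - of_int n" for x n
    using circle_lift_add_int[OF assms, of "- x" "- n"] by simp
  ultimately show ?thesis
    using assms by (auto simp: circle_lift_def commutes_with_int_translations_def strict_mono_def)
qed

lemma funpow_reflect: "((\<lambda>x. - s (- x)) ^^ m) x = - (s ^^ m) (- x)"
  for s :: "real \<Rightarrow> real"
proof (induction m)
  case 0
  show ?case by simp
next
  case (Suc m)
  have "((\<lambda>x. - s (- x)) ^^ Suc m) x = - s (- ((\<lambda>x. - s (- x)) ^^ m) x)"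
    by simp
  also have "\<dots> = - (s ^^ Suc m) (- x)"
    unfolding Suc.IH by simp
  finally show ?case .
qed

lemma basin_reflect:
  assumes b: "basin f r a"
  shows "basin (\<lambda>x. - f (- x)) (- r - 1) (- a)"
proof -
  have "(\<lambda>m. ((\<lambda>x. - f (- x)) ^^ m) x) \<longlonglongrightarrow> - a" if "- r - 1 < x" "x < - r" for x
    unfolding funpow_reflect[of _ f] using that by (intro tendsto_intros basin_tendsto[OF b]) auto
  moreover have "f (r + 1) = r + 1" using b circle_lift_add_1[OF basin_lift[OF b]] by (simp add: basin_def)
  ultimately show ?thesis
    using b circle_lift_reflect[OF basin_lift[OF b]] by (auto simp: basin_def add.commute)
qed

text \<open>Between \<open>r\<close> and \<open>a\<close> the sign of \<open>f x - x\<close> is constant. It is positive near \<open>a\<close>, since \<open>a\<close>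
  attracts a neighbourhood, so orbits increase and their limit is a fixed point, which can only be \<open>a\<close>.\<close>

lemma attracted_from_left:
  assumes f: "circle_lift f" and ra: "r < a" "a < r + 1"
    and att: "attracting_fixpoint f a"
    and only: "\<And>x. r < x \<Longrightarrow> x < r + 1 \<Longrightarrow> f x = x \<Longrightarrow> x = a"
    and x: "r < x" "x \<le> a"
  shows "(\<lambda>n. (f ^^ n) x) \<longlonglongrightarrow> a"
proof -
  obtain U where fa: "f a = a" and U: "open U" "a \<in> U" "\<And>x. x \<in> U \<Longrightarrow> (\<lambda>n. (f ^^ n) x) \<longlonglongrightarrow> a"
    using att unfolding attracting_fixpoint_def by auto
  obtain e where e: "e > 0" "\<And>x. \<bar>x - a\<bar> < e \<Longrightarrow> x \<in> U"
    using U(1,2) by (auto simp: open_dist dist_real_def)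
  have le: "f x \<le> f y" if "x \<le> y" for x y using that circle_lift_le_iff[OF f] by simp
  have contf: "continuous_on A f" for A
    using f by (auto simp: circle_lift_def intro: continuous_on_subset)
  have lim_fix: "f l = l" if "(\<lambda>n. (f ^^ n) x) \<longlonglongrightarrow> l" for l x
  proof -
    have "(\<lambda>n. (f ^^ Suc n) x) \<longlonglongrightarrow> f l" using circle_lift_tendsto[OF f that] by simp
    moreover have "(\<lambda>n. (f ^^ Suc n) x) \<longlonglongrightarrow> l" using that LIMSEQ_Suc by blast
    ultimately show ?thesis using LIMSEQ_unique by blast
  qed
  have up: "y \<le> f y" if y: "r < y" "y \<le> a" for y
  proof (rule ccontr)
    assume "\<not> y \<le> f y"
    then have fy: "f y < y" by simp
    have "y \<noteq> a" using fy fa by auto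
    define z where "z = max y (a - e/2)"
    have z: "y \<le> z" "z < a" "z \<in> U" using y \<open>y \<noteq> a\<close> e by (auto simp: z_def)
    have "f z \<le> z"
    proof (rule ccontr)
      assume "\<not> f z \<le> z"
      then obtain w where "y \<le> w" "w \<le> z" "f w - w = 0"
        using IVT'[of "\<lambda>w. f w - w" y 0 z, OF _ _ z(1) continuous_on_diff[OF contf continuous_on_id]] fy
        by auto
      then show False using only[of w] y z ra by auto
    qed
    then have "(f ^^ n) z \<le> z" for n
    proof (induction n)
      case (Suc n)
      then show ?case using le[of "(f ^^ n) z" z] by (auto intro: order_trans)
    qed simp
    then have "a \<le> z" using U(3)[OF z(3)] LIMSEQ_le_const2 by blast
    then show False using z by simp
  qed
  have bd: "x \<le> (f ^^ n) x \<and> (f ^^ n) x \<le> a" for n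
  proof (induction n)
    case (Suc n)
    then show ?case using up[of "(f ^^ n) x"] le[of "(f ^^ n) x" a] fa x by auto
  qed (use x in simp)
  have "incseq (\<lambda>n. (f ^^ n) x)"
  proof (rule incseq_SucI)
    fix n
    show "(f ^^ n) x \<le> (f ^^ Suc n) x" using up[of "(f ^^ n) x"] bd[of n] x by auto
  qed
  then obtain l where l: "(\<lambda>n. (f ^^ n) x) \<longlonglongrightarrow> l"
    using incseq_convergent[of "\<lambda>n. (f ^^ n) x" a] bd by blast
  have "x \<le> l" "l \<le> a"
    using LIMSEQ_le_const[OF l, of x] LIMSEQ_le_const2[OF l, of a] bd by blast+
  then have "l = a" using only[of l] lim_fix[OF l] x ra by auto
  then show ?thesis using l by simp
qed

text \<open>Points to the right of \<open>a\<close> lie to the left of \<open>- a\<close> for the map conjugated by \<open>x \<mapsto> - x\<close>.\<close>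

lemma basin_if_attracting:
  assumes f: "circle_lift f" and r: "f r = r" and ra: "r < a" "a < r + 1"
    and att: "attracting_fixpoint f a"
    and only: "\<And>x. r < x \<Longrightarrow> x < r + 1 \<Longrightarrow> f x = x \<Longrightarrow> x = a"
  shows "basin f r a"
proof -
  let ?h = "\<lambda>x. - f (- x)"
  obtain U where fa: "f a = a" and U: "open U" "a \<in> U" "\<And>x. x \<in> U \<Longrightarrow> (\<lambda>n. (f ^^ n) x) \<longlonglongrightarrow> a"
    using att unfolding attracting_fixpoint_def by auto
  have "(\<lambda>n. (?h ^^ n) x) \<longlonglongrightarrow> - a" if "x \<in> uminus ` U" for x
    using tendsto_minus[OF U(3)[of "- x"]] that by (auto simp: funpow_reflect[of _ f])
  moreover have "open (uminus ` U)" using U(1) by (rule open_negations)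
  ultimately have att': "attracting_fixpoint ?h (- a)"
    using fa U(2) unfolding attracting_fixpoint_def by auto
  have "(\<lambda>n. (f ^^ n) x) \<longlonglongrightarrow> a" if x: "r < x" "x < r + 1" for x
  proof (cases "x \<le> a")
    case True
    show ?thesis by (rule attracted_from_left[OF f ra att _ x(1) True]) (rule only)
  next
    case False
    have "(\<lambda>n. (?h ^^ n) (- x)) \<longlonglongrightarrow> - a"
    proof (rule attracted_from_left[OF circle_lift_reflect[OF f] _ _ att', where r = "- (r + 1)"])
      show "y = - a" if "- (r + 1) < y" "y < - (r + 1) + 1" "?h y = y" for y
        using only[of "- y"] that by auto
    qed (insert ra x False, auto)
    then have "(\<lambda>n. - (f ^^ n) x) \<longlonglongrightarrow> - a"
      by (simp only: funpow_reflect[of _ f] minus_minus)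
    then show ?thesis by (rule tendsto_minus_cancel)
  qed
  then show ?thesis using f r ra fa by (simp add: basin_def)
qed

section \<open>Minimal actions on the line\<close>

text \<open>Minimality is stated as the existence of a group element that moves \<open>x\<close> into a given interval,
  which is the form in which it is applied.\<close>

locale line_action = group G for G :: "('g, 'm) monoid_scheme" (structure) +
  fixes \<rho> :: "'g \<Rightarrow> real \<Rightarrow> real"
  assumes act_mult: "g \<in> carrier G \<Longrightarrow> h \<in> carrier G \<Longrightarrow> \<rho> (g \<otimes> h) x = \<rho> g (\<rho> h x)"
    and act_one: "\<rho> \<one> x = x"
    and act_lift: "g \<in> carrier G \<Longrightarrow> circle_lift (\<rho> g)"
    and act_dense: "c < d \<Longrightarrow> \<exists>g\<in>carrier G. c < \<rho> g x \<and> \<rho> g x < d"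
begin

lemma act_inv: "g \<in> carrier G \<Longrightarrow> \<rho> (inv g) (\<rho> g x) = x"
  using act_mult[of "inv g" g x] act_one by simp

lemma act_inv': "g \<in> carrier G \<Longrightarrow> \<rho> g (\<rho> (inv g) x) = x"
  using act_mult[of g "inv g" x] act_one by simp

lemma act_pow: "g \<in> carrier G \<Longrightarrow> \<rho> (g [^] m) = \<rho> g ^^ m"
proof (induction m)
  case 0
  then show ?case by (simp add: fun_eq_iff act_one)
next
  case (Suc m)
  then show ?case by (simp add: fun_eq_iff act_mult funpow_swap1)
qed

lemma act_less_iff: "g \<in> carrier G \<Longrightarrow> \<rho> g x < \<rho> g y \<longleftrightarrow> x < y"
  using circle_lift_less_iff act_lift by blast

lemma act_le_iff: "g \<in> carrier G \<Longrightarrow> \<rho> g x \<le> \<rho> g y \<longleftrightarrow> x \<le> y"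
  using circle_lift_le_iff act_lift by blast

lemma act_add_int: "g \<in> carrier G \<Longrightarrow> \<rho> g (x + of_int n) = \<rho> g x + of_int n"
  using circle_lift_add_int act_lift by blast

lemma act_add_1: "g \<in> carrier G \<Longrightarrow> \<rho> g (x + 1) = \<rho> g x + 1"
  using circle_lift_add_1 act_lift by blast

lemma act_inv_less_iff: "g \<in> carrier G \<Longrightarrow> \<rho> (inv g) x < y \<longleftrightarrow> x < \<rho> g y"
  by (metis act_inv act_less_iff act_inv')

lemma act_less_inv_iff: "g \<in> carrier G \<Longrightarrow> y < \<rho> (inv g) x \<longleftrightarrow> \<rho> g y < x"
  by (metis act_inv act_less_iff act_inv')

lemma act_into_open:
  assumes "open U" "x0 \<in> U"
  shows "\<exists>g\<in>carrier G. \<rho> g x \<in> U"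
proof -
  obtain e where e: "e > 0" "\<And>x. \<bar>x - x0\<bar> < e \<Longrightarrow> x \<in> U"
    using assms by (auto simp: open_dist dist_real_def)
  obtain g where g: "g \<in> carrier G" "x0 - e < \<rho> g x" "\<rho> g x < x0 + e"
    using act_dense[of "x0 - e" "x0 + e" x] e by auto
  then have "\<bar>\<rho> g x - x0\<bar> < e" by (simp add: abs_less_iff)
  then show ?thesis using g e by blast
qed

lemma moves_up_conj:
  assumes "g \<in> carrier G" "c \<in> carrier G" "moves_up (\<rho> g)"
  shows "moves_up (\<rho> (c \<otimes> g \<otimes> inv c))"
  unfolding moves_up_def
proof
  fix x
  have "\<rho> (inv c) x < \<rho> g (\<rho> (inv c) x)" using assms(3) by (simp add: moves_up_def)
  then show "x < \<rho> (c \<otimes> g \<otimes> inv c) x"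
    using assms(1,2) by (simp add: act_mult act_inv_less_iff)
qed

text \<open>The key criterion: the order of the orbit of \<open>a\<close> can be read off from the group, once it is known
  which elements fix a point and which ones move every point up.

  If \<open>a < \<rho> k a\<close>, minimality gives \<open>q\<close> such that \<open>r + 1\<close> separates \<open>\<rho> q a\<close> from \<open>\<rho> q (\<rho> k a)\<close>.
  Then \<open>q g\<^sup>m\<close> maps a subinterval of the basin into itself, while \<open>q k g\<^sup>m\<close> pushes the basin beyond
  its right end. Conversely, if \<open>\<rho> k a \<le> a\<close> and \<open>q k g\<^sup>m\<close> moves up for all large \<open>m\<close>, then
  \<open>\<rho> q a \<ge> \<rho> q (\<rho> k a) \<ge> r + 1\<close>, so \<open>q g\<^sup>m\<close> itself moves up for large \<open>m\<close> and has no fixed point.\<close>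

lemma moves_attractor_right_iff:
  assumes g: "g \<in> carrier G" and b: "basin (\<rho> g) r a" and k: "k \<in> carrier G"
  shows "a < \<rho> k a \<longleftrightarrow>
    (\<exists>q\<in>carrier G. \<forall>\<^sub>F m in sequentially.
      (\<exists>x. \<rho> (q \<otimes> g [^] (m::nat)) x = x) \<and> moves_up (\<rho> (q \<otimes> k \<otimes> g [^] m)))"
proof
  have ra: "r < a" "a < r + 1" using b by (auto simp: basin_def)
  have qg: "\<rho> (q \<otimes> g [^] m) = (\<lambda>x. \<rho> q ((\<rho> g ^^ m) x))" if "q \<in> carrier G" for q m
    using that g by (simp add: fun_eq_iff act_mult act_pow)
  have qkg: "\<rho> (q \<otimes> k \<otimes> g [^] m) = (\<lambda>x. \<rho> q (\<rho> k ((\<rho> g ^^ m) x)))" if "q \<in> carrier G" for q m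
    using that g k by (simp add: fun_eq_iff act_mult act_pow)
  {
    assume ak: "a < \<rho> k a"
    \<comment> \<open>Bounding \<open>\<rho> p (r + 1)\<close> by \<open>a + 1\<close> keeps \<open>\<rho> q a\<close> to the right of \<open>r\<close>.\<close>
    then obtain p where p: "p \<in> carrier G" "a < \<rho> p (r + 1)" "\<rho> p (r + 1) < min (\<rho> k a) (a + 1)"
      using act_dense[of a "min (\<rho> k a) (a + 1)"] by auto
    define q where "q = inv p"
    have q: "q \<in> carrier G" using p q_def by simp
    have pq: "\<rho> q x < y \<longleftrightarrow> x < \<rho> p y" "y < \<rho> q x \<longleftrightarrow> \<rho> p y < x" for x y
      using act_inv_less_iff act_less_inv_iff p(1) q_def by auto
    have p1: "\<rho> p (r + 1) = \<rho> p r + 1" using act_add_1 p(1) by simp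
    have qa: "r < \<rho> q a" "\<rho> q a < r + 1" using pq p p1 by auto
    have qka: "r + 1 < \<rho> q (\<rho> k a)" using pq p by auto
    have "\<rho> k a < \<rho> k r + 1" using act_less_iff[OF k] act_add_1[OF k, of r] ra by metis
    then have qkr: "r < \<rho> q (\<rho> k r)" using pq p p1 by auto
    have "\<forall>\<^sub>F m in sequentially. \<exists>x. \<rho> q ((\<rho> g ^^ m) x) = x"
      using eventually_fixed_point_in_basin[OF b act_lift[OF q]] qa by blast
    moreover have "\<forall>\<^sub>F m in sequentially. moves_up (\<lambda>x. \<rho> q (\<rho> k ((\<rho> g ^^ m) x)))"
      by (rule eventually_moves_up_past_basin[OF b circle_lift_comp[OF act_lift[OF q] act_lift[OF k]]])
        (insert qka qkr, auto)
    ultimately have "\<forall>\<^sub>F m in sequentially. (\<exists>x. \<rho> (q \<otimes> g [^] (m::nat)) x = x) \<and>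
        moves_up (\<rho> (q \<otimes> k \<otimes> g [^] m))"
      unfolding qg[OF q] qkg[OF q] by (rule eventually_conj)
    then show "\<exists>q\<in>carrier G. \<forall>\<^sub>F m in sequentially. (\<exists>x. \<rho> (q \<otimes> g [^] (m::nat)) x = x) \<and>
        moves_up (\<rho> (q \<otimes> k \<otimes> g [^] m))" using q by blast
  next
    assume "\<exists>q\<in>carrier G. \<forall>\<^sub>F m in sequentially. (\<exists>x. \<rho> (q \<otimes> g [^] (m::nat)) x = x) \<and>
        moves_up (\<rho> (q \<otimes> k \<otimes> g [^] m))"
    then obtain q where q: "q \<in> carrier G"
      and fixed: "\<forall>\<^sub>F m in sequentially. \<exists>x. \<rho> q ((\<rho> g ^^ m) x) = x"
      and up: "\<forall>\<^sub>F m in sequentially. moves_up (\<lambda>x. \<rho> q (\<rho> k ((\<rho> g ^^ m) x)))"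
      using qg qkg by (auto simp: eventually_conj_iff)
    show "a < \<rho> k a"
    proof (rule ccontr)
      assume "\<not> a < \<rho> k a"
      then have "\<rho> q (\<rho> k a) \<le> \<rho> q a" using act_le_iff[OF q] by simp
      have qa: "r + 1 \<le> \<rho> q a"
      proof (rule ccontr)
        assume "\<not> r + 1 \<le> \<rho> q a"
        then obtain x where x: "a < x" "\<rho> q a < x" "x < r + 1"
          using ra dense[of "max a (\<rho> q a)" "r + 1"] by auto
        have lim: "(\<lambda>m. \<rho> q (\<rho> k ((\<rho> g ^^ m) x))) \<longlonglongrightarrow> \<rho> q (\<rho> k a)"
          by (rule circle_lift_tendsto[OF act_lift[OF q] circle_lift_tendsto[OF act_lift[OF k]
                basin_tendsto[OF b]]]) (use x ra in auto)
        have "\<forall>\<^sub>F m in sequentially. x \<le> \<rho> q (\<rho> k ((\<rho> g ^^ m) x))"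
          using up by (rule eventually_mono) (simp add: moves_up_def less_imp_le)
        then have "x \<le> \<rho> q (\<rho> k a)" using tendsto_lowerbound[OF lim] by simp
        then show False using x \<open>\<rho> q (\<rho> k a) \<le> \<rho> q a\<close> by simp
      qed
      moreover have "r < \<rho> q r"
        using act_less_iff[OF q, of a "r + 1"] act_add_1[OF q, of r] qa ra by simp
      ultimately have "\<forall>\<^sub>F m in sequentially. moves_up (\<lambda>x. \<rho> q ((\<rho> g ^^ m) x))"
        by (rule eventually_moves_up_past_basin[OF b act_lift[OF q]])
      with fixed have "\<forall>\<^sub>F m in sequentially. False"
      proof eventually_elim
        case (elim m)
        then show ?case unfolding moves_up_def by (metis less_irrefl)
      qed
      then show False by simp
    qed
  }
qed

text \<open>A reference element for comparing directions: it moves all points up, by less than \<open>1\<close> at some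
  points and by at least \<open>1\<close> at others. It is \<open>q g\<^sup>m\<close> for a \<open>q\<close> that carries \<open>a\<close> into the next basin
  \<open>(r + 1, r + 2)\<close>: its composition with the translation by \<open>-1\<close> fixes a point of the basin.\<close>

lemma ex_moves_up_crossing_translation:
  assumes g: "g \<in> carrier G" and b: "basin (\<rho> g) r a"
  shows "\<exists>k\<in>carrier G. moves_up (\<rho> k) \<and> (\<exists>x. \<rho> k x < x + 1) \<and> (\<exists>x. x + 1 \<le> \<rho> k x)"
proof -
  have ra: "r < a" "a < r + 1" using b by (auto simp: basin_def)
  obtain p where p: "p \<in> carrier G" "a - 1 < \<rho> p (r + 1)" "\<rho> p (r + 1) < a"
    using act_dense[of "a - 1" a "r + 1"] by auto
  define q where "q = inv p"
  have q: "q \<in> carrier G" using p q_def by simp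
  have pq: "\<rho> q x < y \<longleftrightarrow> x < \<rho> p y" "y < \<rho> q x \<longleftrightarrow> \<rho> p y < x" for x y
    using act_inv_less_iff act_less_inv_iff p(1) q_def by auto
  have p1: "\<rho> p (r + 1) = \<rho> p r + 1" using act_add_1 p(1) by simp
  have "\<rho> q (a - 1) = \<rho> q a - 1" using circle_lift_diff_1 act_lift q by blast
  then have qa: "r + 1 < \<rho> q a" "\<rho> q a < r + 2" using pq(1)[where x = "a - 1" and y = "r + 1"] pq(2)[where x = a and y = "r + 1"] p by auto
  have qr: "r < \<rho> q r" using pq p p1 ra by auto
  have up: "\<forall>\<^sub>F m in sequentially. moves_up (\<lambda>x. \<rho> q ((\<rho> g ^^ m) x))"
    by (rule eventually_moves_up_past_basin[OF b act_lift[OF q]]) (use qa qr in auto)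
  have "\<forall>\<^sub>F m in sequentially. \<exists>x. \<rho> q ((\<rho> g ^^ m) x) + of_int (-1) = x"
    by (rule eventually_fixed_point_in_basin[OF b circle_lift_translate[OF act_lift[OF q]]])
      (use qa in auto)
  moreover obtain y where y: "r < y" "\<rho> q a - 1 < y" "y < r + 1"
    using qa dense[of "max r (\<rho> q a - 1)" "r + 1"] by auto
  have "(\<lambda>m. \<rho> q ((\<rho> g ^^ m) y)) \<longlonglongrightarrow> \<rho> q a"
    by (rule circle_lift_tendsto[OF act_lift[OF q] basin_tendsto[OF b y(1,3)]])
  then have "\<forall>\<^sub>F m in sequentially. \<rho> q ((\<rho> g ^^ m) y) < y + 1"
    by (rule order_tendstoD) (use y in simp)
  ultimately have "\<forall>\<^sub>F m in sequentially. moves_up (\<lambda>x. \<rho> q ((\<rho> g ^^ m) x)) \<and>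
      \<rho> q ((\<rho> g ^^ m) y) < y + 1 \<and> (\<exists>x. \<rho> q ((\<rho> g ^^ m) x) + of_int (-1) = x)"
    using up by (intro eventually_conj)
  then obtain m where m: "moves_up (\<lambda>x. \<rho> q ((\<rho> g ^^ m) x))"
    "\<rho> q ((\<rho> g ^^ m) y) < y + 1" "\<exists>x. \<rho> q ((\<rho> g ^^ m) x) + of_int (-1) = x"
    using eventually_happens'[OF sequentially_bot] by blast
  then obtain x where "\<rho> q ((\<rho> g ^^ m) x) + of_int (-1) = x" by blast
  then have "x + 1 \<le> \<rho> q ((\<rho> g ^^ m) x)" by simp
  moreover have "\<rho> (q \<otimes> g [^] m) = (\<lambda>x. \<rho> q ((\<rho> g ^^ m) x))"
    using q g by (simp add: fun_eq_iff act_mult act_pow)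
  ultimately show ?thesis using m q g by (intro bexI[of _ "q \<otimes> g [^] m"]) auto
qed

lemma line_action_reflect: "line_action G (\<lambda>g x. - \<rho> g (- x))"
proof (unfold_locales)
  fix c d x :: real
  assume "c < d"
  then obtain g where "g \<in> carrier G" "- d < \<rho> g (- x)" "\<rho> g (- x) < - c"
    using act_dense[of "- d" "- c" "- x"] by auto
  then show "\<exists>g\<in>carrier G. c < - \<rho> g (- x) \<and> - \<rho> g (- x) < d" by (intro bexI[of _ g]) auto
qed (auto simp: act_mult act_one intro: circle_lift_reflect act_lift)

end

section \<open>Minimal free actions\<close>

context line_action
begin

text \<open>For a free action the intermediate value theorem makes the order of \<open>\<rho> g x\<close> and \<open>\<rho> h x\<close> independent
  of \<open>x\<close>, so that \<open>G\<close> carries a bi-invariant total order. The following lemmas are the classical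
  argument of Hoelder that an Archimedean ordered group is abelian.\<close>

lemma free_less:
  assumes free: "\<forall>g\<in>carrier G. g \<noteq> \<one> \<longrightarrow> (\<forall>x. \<rho> g x \<noteq> x)"
    and g: "g \<in> carrier G" and h: "h \<in> carrier G" and less: "\<rho> g x < \<rho> h x"
  shows "\<rho> g y < \<rho> h y"
proof -
  let ?k = "inv g \<otimes> h"
  have k: "?k \<in> carrier G" using g h by simp
  have kx: "z < \<rho> ?k z \<longleftrightarrow> \<rho> g z < \<rho> h z" for z using g h by (simp add: act_mult act_less_inv_iff)
  then have "?k \<noteq> \<one>" using less act_one by fastforce
  then have "moves_up (\<rho> ?k) \<or> (\<forall>z. \<rho> ?k z < z)"
    using moves_up_or_down[OF act_lift[OF k]] free k by blast
  then show ?thesis using kx less by (metis moves_up_def not_less_iff_gr_or_eq)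
qed

text \<open>By density some \<open>c\<close> lies strictly between the identity and \<open>e\<close>; the smaller one of \<open>c\<close>
  and \<open>inv c \<otimes> e\<close> has a square that is at most \<open>e\<close>.\<close>

lemma free_ex_square_root:
  assumes free: "\<forall>g\<in>carrier G. g \<noteq> \<one> \<longrightarrow> (\<forall>x. \<rho> g x \<noteq> x)"
    and e: "e \<in> carrier G" and up: "moves_up (\<rho> e)"
  shows "\<exists>d\<in>carrier G. moves_up (\<rho> d) \<and> (\<forall>x. \<rho> d (\<rho> d x) \<le> \<rho> e x)"
proof -
  have less: "\<rho> g y < \<rho> h y" if "g \<in> carrier G" "h \<in> carrier G" "\<rho> g x < \<rho> h x" for g h x y
    using free_less[OF free that] .
  obtain c where c: "c \<in> carrier G" "0 < \<rho> c 0" "\<rho> c 0 < \<rho> e 0"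
    using act_dense[of 0 "\<rho> e 0" 0] up by (auto simp: moves_up_def)
  have c_up: "moves_up (\<rho> c)" using less[of \<one> c 0] c act_one by (simp add: moves_up_def)
  have ce: "\<rho> c y < \<rho> e y" for y using less c e by blast
  show ?thesis
  proof (cases "\<forall>x. \<rho> c (\<rho> c x) \<le> \<rho> e x")
    case True
    then show ?thesis using c_up c by blast
  next
    case False
    then obtain x where "\<rho> e x < \<rho> (c \<otimes> c) x" using c by (auto simp: act_mult not_le)
    then have ecc: "\<rho> e y < \<rho> c (\<rho> c y)" for y using less[of e "c \<otimes> c" x y] c e by (simp add: act_mult)
    let ?d = "inv c \<otimes> e"
    have "moves_up (\<rho> ?d)" using ce c e by (simp add: moves_up_def act_mult act_less_inv_iff)
    moreover have "\<rho> ?d (\<rho> ?d y) \<le> \<rho> e y" for y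
    proof -
      have "\<rho> ?d z < \<rho> c z" for z using ecc c e by (simp add: act_mult act_inv_less_iff)
      then have "\<rho> ?d (\<rho> ?d y) < \<rho> c (\<rho> ?d y)" .
      then show ?thesis using c e by (simp add: act_mult act_inv')
    qed
    ultimately show ?thesis using c e by blast
  qed
qed

text \<open>The increasing orbit of \<open>0\<close> under a map that moves up is unbounded, as its limit would be fixed.\<close>

lemma archimedean:
  assumes d: "d \<in> carrier G" and up: "moves_up (\<rho> d)" and "0 \<le> z"
  shows "\<exists>m. (\<rho> d ^^ m) 0 \<le> z \<and> z < (\<rho> d ^^ Suc m) 0"
proof -
  have "\<exists>n. z < (\<rho> d ^^ n) 0"
  proof (rule ccontr)
    assume "\<nexists>n. z < (\<rho> d ^^ n) 0"
    moreover have "incseq (\<lambda>n. (\<rho> d ^^ n) 0)"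
      using up by (intro incseq_SucI) (simp add: moves_up_def less_imp_le)
    moreover have "\<forall>n. (\<rho> d ^^ n) 0 \<le> z" using calculation(1) by (simp add: not_less)
    ultimately obtain l where l: "(\<lambda>n. (\<rho> d ^^ n) 0) \<longlonglongrightarrow> l"
      using incseq_convergent by blast
    have "(\<lambda>n. (\<rho> d ^^ Suc n) 0) \<longlonglongrightarrow> \<rho> d l" using circle_lift_tendsto[OF act_lift[OF d] l] by simp
    then have "\<rho> d l = l" using LIMSEQ_unique LIMSEQ_Suc[OF l] by blast
    then show False using up by (metis moves_up_def less_irrefl)
  qed
  then obtain n where n: "z < (\<rho> d ^^ n) 0" "\<forall>i<n. \<not> z < (\<rho> d ^^ i) 0"
    using exists_least_iff[of "\<lambda>n. z < (\<rho> d ^^ n) 0"] by auto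
  then obtain m where "n = Suc m" using assms(3) by (cases n) auto
  then show ?thesis using n by (intro exI[of _ m]) auto
qed

text \<open>Suppose that \<open>g\<close> and \<open>h\<close> move up, but \<open>h g < g h\<close>. Then \<open>e = g h (inv (h g))\<close> moves up too.
  Take \<open>d\<close> that moves up with \<open>d\<^sup>2 \<le> e\<close>, and \<open>m\<close>, \<open>n\<close> with \<open>d\<^sup>m \<le> g < d\<^bsup>m + 1\<^esup>\<close> and
  \<open>d\<^sup>n \<le> h < d\<^bsup>n + 1\<^esup>\<close>. Then \<open>g h < d\<^bsup>m + n + 2\<^esup> \<le> d\<^sup>2 h g \<le> e h g = g h\<close>, which is absurd.
  By symmetry \<open>g\<close> and \<open>h\<close> commute, and the general case follows by passing to inverses.\<close>

lemma free_imp_comm_group: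
  assumes free: "\<forall>g\<in>carrier G. g \<noteq> \<one> \<longrightarrow> (\<forall>x. \<rho> g x \<noteq> x)"
  shows "comm_group G"
proof -
  have less: "\<rho> g y < \<rho> h y" if "g \<in> carrier G" "h \<in> carrier G" "\<rho> g x < \<rho> h x" for g h x y
    using free_less[OF free that] .
  then have le: "\<rho> g y \<le> \<rho> h y" if "g \<in> carrier G" "h \<in> carrier G" "\<rho> g x \<le> \<rho> h x" for g h x y
    using that by (meson not_less)
  have not_less_commutator: "\<not> \<rho> (h \<otimes> g) 0 < \<rho> (g \<otimes> h) 0"
    if g: "g \<in> carrier G" "moves_up (\<rho> g)" and h: "h \<in> carrier G" "moves_up (\<rho> h)" for g h
  proof
    assume lt: "\<rho> (h \<otimes> g) 0 < \<rho> (g \<otimes> h) 0"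
    define e where "e = g \<otimes> h \<otimes> inv (h \<otimes> g)"
    have e: "e \<in> carrier G" using g h e_def by simp
    have e_hg: "\<rho> e (\<rho> h (\<rho> g x)) = \<rho> g (\<rho> h x)" for x
      using act_inv[of "h \<otimes> g" x] g h unfolding e_def by (simp add: act_mult)
    have "moves_up (\<rho> e)"
      unfolding moves_up_def
    proof
      fix x
      let ?y = "\<rho> (inv (h \<otimes> g)) x"
      have "\<rho> (h \<otimes> g) ?y < \<rho> (g \<otimes> h) ?y" using less[of "h \<otimes> g" "g \<otimes> h"] lt g h by blast
      moreover have "\<rho> (h \<otimes> g) ?y = x" using act_inv' g h by simp
      moreover have "\<rho> (g \<otimes> h) ?y = \<rho> e x" using g h unfolding e_def by (simp only: act_mult m_closed inv_closed)
      ultimately show "x < \<rho> e x" by simp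
    qed
    then obtain d where d: "d \<in> carrier G" "moves_up (\<rho> d)" and dd: "\<And>x. \<rho> d (\<rho> d x) \<le> \<rho> e x"
      using free_ex_square_root[OF free e] by blast
    let ?p = "\<lambda>m. \<rho> d ^^ m"
    have sandwich: "\<exists>m. \<forall>x. ?p m x \<le> \<rho> k x \<and> \<rho> k x < ?p (Suc m) x"
      if k: "k \<in> carrier G" "moves_up (\<rho> k)" for k
    proof -
      have "0 \<le> \<rho> k 0" using k by (simp add: moves_up_def less_imp_le)
      then obtain m where "\<rho> (d [^] m) 0 \<le> \<rho> k 0" "\<rho> k 0 < \<rho> (d [^] Suc m) 0"
        using archimedean[OF d] unfolding act_pow[OF d(1)] by blast
      then have "\<forall>x. \<rho> (d [^] m) x \<le> \<rho> k x \<and> \<rho> k x < \<rho> (d [^] Suc m) x"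
        using le[of "d [^] m" k 0] less[of k "d [^] Suc m" 0] k(1) d(1) by simp
      then show ?thesis unfolding act_pow[OF d(1)] by blast
    qed
    obtain m n where m: "\<And>x. ?p m x \<le> \<rho> g x" "\<And>x. \<rho> g x < ?p (Suc m) x"
      and n: "\<And>x. ?p n x \<le> \<rho> h x" "\<And>x. \<rho> h x < ?p (Suc n) x"
      using sandwich g h by meson
    have mono: "?p i x \<le> ?p i y" if "x \<le> y" for i x y
      using that circle_lift_le_iff[OF circle_lift_funpow[OF act_lift[OF d(1)]]] by simp
    have "\<rho> g (\<rho> h 0) < ?p (Suc m) (\<rho> h 0)" by (rule m)
    also have "\<dots> \<le> ?p (Suc m) (?p (Suc n) 0)" using n(2) by (intro mono less_imp_le)
    also have "\<dots> = ?p (Suc m + Suc n) 0" by (simp only: funpow_add comp_apply)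
    also have "\<dots> = ?p (Suc (Suc (n + m))) 0" by (simp only: add_Suc add_Suc_right add.commute)
    also have "\<dots> = \<rho> d (\<rho> d (?p n (?p m 0)))" by (simp only: funpow.simps funpow_add comp_apply)
    also have "\<dots> \<le> \<rho> d (\<rho> d (?p n (\<rho> g 0)))"
      by (simp only: act_le_iff[OF d(1)] m(1) mono)
    also have "\<dots> \<le> \<rho> d (\<rho> d (\<rho> h (\<rho> g 0)))"
      by (simp only: act_le_iff[OF d(1)] n(1))
    also have "\<dots> \<le> \<rho> g (\<rho> h 0)" using dd[of "\<rho> h (\<rho> g 0)"] e_hg by simp
    finally show False by simp
  qed
  have comm_up: "g \<otimes> h = h \<otimes> g"
    if g: "g \<in> carrier G" "moves_up (\<rho> g)" and h: "h \<in> carrier G" "moves_up (\<rho> h)" for g h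
  proof -
    have eq: "\<rho> (g \<otimes> h) 0 = \<rho> (h \<otimes> g) 0"
      using not_less_commutator[OF g h] not_less_commutator[OF h g] by linarith
    have "\<rho> (inv (h \<otimes> g) \<otimes> (g \<otimes> h)) 0 = 0"
      using act_mult[of "inv (h \<otimes> g)" "g \<otimes> h" 0] act_inv[of "h \<otimes> g" 0] eq g h by simp
    then have "inv (h \<otimes> g) \<otimes> (g \<otimes> h) = \<one>" using free g h by (metis inv_closed m_closed)
    then show ?thesis using g h by (metis inv_closed inv_equality inv_inv m_closed)
  qed
  have up_cases: "g = \<one> \<or> moves_up (\<rho> g) \<or> moves_up (\<rho> (inv g))" if g: "g \<in> carrier G" for g
    using moves_up_or_down[OF act_lift[OF g]] free g
    by (auto simp: moves_up_def act_less_inv_iff)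
  have comm_inv: "g \<otimes> h = h \<otimes> g" if "g \<in> carrier G" "h \<in> carrier G" "inv g \<otimes> h = h \<otimes> inv g" for g h
    using that by (metis inv_solve_left inv_solve_right m_assoc m_closed inv_closed)
  have "g \<otimes> h = h \<otimes> g" if g: "g \<in> carrier G" and h: "h \<in> carrier G" for g h
  proof -
    have right: "k \<otimes> h = h \<otimes> k" if k: "k \<in> carrier G" "moves_up (\<rho> k)" for k
      using up_cases[OF h] comm_up[OF k, of h] comm_up[OF k, of "inv h"] comm_inv[of h k] h k by auto
    show ?thesis
      using up_cases[OF g] right[of g] right[of "inv g"] comm_inv[of g h] h g by auto
  qed
  then show ?thesis by (intro group_comm_groupI)
qed

end

section \<open>Comparing the directions of motion\<close>

locale two_line_actions = first: line_action G \<rho> + second: line_action G \<sigma>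
  for G :: "('g, 'm) monoid_scheme" (structure) and \<rho> \<sigma> +
  assumes same_fixing: "g \<in> carrier G \<Longrightarrow> (\<exists>x. \<rho> g x = x) \<longleftrightarrow> (\<exists>x. \<sigma> g x = x)"
begin

text \<open>If the graphs of \<open>\<rho> k\<close> and \<open>\<rho> w\<close> crossed, \<open>inv w \<otimes> k\<close> would fix a point under \<open>\<rho>\<close>. But under \<open>\<sigma>\<close> it is
  a product of two elements that move up.\<close>

lemma no_crossing:
  assumes k: "k \<in> carrier G" "moves_up (\<sigma> k)" and w: "w \<in> carrier G" "\<forall>x. \<sigma> w x < x"
    and x: "\<rho> k x \<le> \<rho> w x" and y: "\<rho> w y \<le> \<rho> k y"
  shows False
proof -
  obtain z where "\<rho> k z = \<rho> w z"
    using fixed_point_between[of "\<rho> k" "\<rho> w" x y] first.act_lift k w x y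
    by (auto simp: circle_lift_def)
  then have "\<rho> (inv w \<otimes> k) z = z" using k w by (simp add: first.act_mult first.act_inv)
  then obtain z' where "\<sigma> (inv w \<otimes> k) z' = z'" using same_fixing k w by blast
  then have "\<sigma> k z' = \<sigma> w z'" using k w by (metis second.act_mult second.act_inv' first.inv_closed)
  moreover have "\<sigma> w z' < z'" "z' < \<sigma> k z'" using k w by (auto simp: moves_up_def)
  ultimately show False by simp
qed

text \<open>Under \<open>\<sigma>\<close> conjugates of \<open>u\<close> move down and conjugates of powers of \<open>k\<close> move up, so by \<open>no_crossing\<close>
  their graphs under \<open>\<rho>\<close> never cross. The contradiction is a crossing.

  If some displacement \<open>\<rho> u x - x\<close> is not an integer, then by minimality a conjugate \<open>v\<close> of \<open>u\<close> displaces \<open>r\<close> by an amount strictly between \<open>j\<close> and \<open>j + 1\<close>.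
  Conjugating \<open>v\<close> by \<open>g\<^sup>n\<close> then gives, in the limit, the staircase that takes the value \<open>a + j\<close>
  on \<open>(a - 1, a)\<close>. Its displacement is close to \<open>j + 1\<close> just to the right of \<open>a - 1\<close>
  and smaller than \<open>j + 1\<close> in the rest of the interval. A conjugate \<open>k'\<close> of \<open>k\<close> displaces \<open>a\<close> by less than
  \<open>1\<close> and some point \<open>y\<close> of \<open>(a - 1, a)\<close> by at least \<open>1\<close>; hence its power with exponent \<open>j + 1\<close>
  is below the staircase near \<open>a - 1\<close> and above it at \<open>y\<close>.

  In the remaining case all displacements of \<open>u\<close> are integers, \<open>u\<close> is a translation by \<open>j + 1\<close>,
  and it is crossed by the power of \<open>k\<close> with exponent \<open>j + 1\<close>.\<close>

lemma not_down_if_up: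
  assumes g: "g \<in> carrier G" and b: "basin (\<rho> g) r a"
    and k: "k \<in> carrier G" "moves_up (\<sigma> k)" "\<rho> k x0 < x0 + 1" "x1 + 1 \<le> \<rho> k x1"
    and u: "u \<in> carrier G" "moves_up (\<rho> u)" and u_down: "\<forall>x. \<sigma> u x < x"
  shows False
proof (cases "\<exists>r0 i. r0 + of_int i < \<rho> u r0 \<and> \<rho> u r0 < r0 + of_int i + 1")
  case True
  then obtain r0 i where i: "r0 + of_int i < \<rho> u r0" "\<rho> u r0 < r0 + of_int i + 1" by blast
  have "r0 < \<rho> u r0" using u by (simp add: moves_up_def)
  then have "0 \<le> i" using i by linarith
  then obtain j where j: "i = int j" using nonneg_int_cases by blast
  have cont: "continuous_on UNIV (\<rho> h)" if "h \<in> carrier G" for h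
    using first.act_lift[OF that] by (simp add: circle_lift_def)
  have shifts: "\<rho> h (x + 1) = \<rho> h x + 1" "\<rho> h (x + real j) = \<rho> h x + real j" if "h \<in> carrier G" for h x
    using first.act_add_1[OF that] first.act_add_int[OF that, of x "int j"] by auto
  have open_shift: "open {x. x + real j < \<rho> h x \<and> \<rho> h x < x + real j + 1}"
      "open {x. r + real j < \<rho> h x \<and> \<rho> h x < r + real j + 1}" "open {x. \<rho> h x < x + 1}"
    if "h \<in> carrier G" for h
    by (intro open_Collect_conj open_Collect_less continuous_intros cont[OF that])+

  obtain c where c: "c \<in> carrier G" "\<rho> c r + real j < \<rho> u (\<rho> c r)" "\<rho> u (\<rho> c r) < \<rho> c r + real j + 1"
    using first.act_into_open[OF open_shift(1)[OF u(1)], of r0 r] i j by auto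
  define v where "v = inv c \<otimes> u \<otimes> c"
  have v: "v \<in> carrier G" using c u v_def by simp
  have v_act: "\<rho> v x = \<rho> (inv c) (\<rho> u (\<rho> c x))" for x
    using c u by (simp add: v_def first.act_mult)
  have "r \<in> {x. r + real j < \<rho> v x \<and> \<rho> v x < r + real j + 1}"
    using c shifts(2)[OF c(1), of r] shifts(2)[OF c(1), of "r + 1"] shifts(1)[OF c(1), of r]
    unfolding v_act
    by (simp add: first.act_less_inv_iff first.act_inv_less_iff add.commute add.left_commute)
  then obtain e0 where e0: "e0 > 0"
    "\<And>x. \<bar>x - r\<bar> < e0 \<Longrightarrow> r + real j < \<rho> v x \<and> \<rho> v x < r + real j + 1"
    using open_shift(2)[OF v] unfolding open_dist dist_real_def by blast
  \<comment> \<open>The images under \<open>g ^^ n\<close> of \<open>r - e\<close> and \<open>r + e\<close> tend to \<open>a - 1\<close> and \<open>a\<close>: they bracket the step.\<close>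
  define e where "e = min (e0 / 2) (1 / 2)"
  have e: "0 < e" "e < 1" "e < e0" using e0(1) by (auto simp: e_def)

  obtain c' where c': "c' \<in> carrier G" "\<rho> k (\<rho> c' a) < \<rho> c' a + 1"
    using first.act_into_open[OF open_shift(3)[OF k(1)], of x0 a] k(3) by auto
  define k' where "k' = inv c' \<otimes> k \<otimes> c'"
  have k': "k' \<in> carrier G" using c' k k'_def by simp
  have k'_act: "\<rho> k' x = \<rho> (inv c') (\<rho> k (\<rho> c' x))" for x
    using c' k by (simp add: k'_def first.act_mult)
  have "\<rho> k' a < a + 1"
    using c' shifts(1)[OF c'(1), of a] by (simp add: k'_act first.act_inv_less_iff)
  then have Ka: "(\<rho> k' ^^ Suc j) a < a + real (Suc j)"
    using funpow_less_shift first.act_lift k' by blast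
  have k'_lift: "circle_lift (\<rho> k')" using first.act_lift k' by blast
  let ?y0 = "\<rho> (inv c') x1"
  obtain m :: int where m: "a - 1 \<le> ?y0 + of_int m" "?y0 + of_int m < a - 1 + 1"
    using ex_int_translate_into_unit_interval by blast
  define y where "y = ?y0 + of_int m"
  have "\<rho> (inv c') (x1 + 1) \<le> \<rho> k' ?y0"
    using c' k(4) by (simp add: k'_act first.act_inv' first.act_le_iff)
  then have y1: "y + 1 \<le> \<rho> k' y"
    using circle_lift_add_int[OF k'_lift, of ?y0 m] shifts(1)[of "inv c'" x1] c' by (simp add: y_def)
  moreover have "y \<noteq> a - 1"
    using y1 \<open>\<rho> k' a < a + 1\<close> circle_lift_diff_1[OF k'_lift, of a] by auto
  ultimately have y: "a - 1 < y" "y < a" "y + 1 \<le> \<rho> k' y" using m by (auto simp: y_def)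
  then have Ky: "y + real (Suc j) \<le> (\<rho> k' ^^ Suc j) y"
    using funpow_ge_shift first.act_lift k' by blast

  have K: "circle_lift (\<rho> k' ^^ Suc j)" using circle_lift_funpow first.act_lift k' by blast
  have lim_right: "(\<lambda>n. (\<rho> g ^^ n) (r + e)) \<longlonglongrightarrow> a"
    by (rule basin_tendsto[OF b]) (use e in auto)
  have lim_left: "(\<lambda>n. (\<rho> g ^^ n) (r - e)) \<longlonglongrightarrow> a - 1"
    using basin_tendsto_shift[OF b, of "-1" "r - e"] e by simp
  have lim_v: "(\<lambda>n. (\<rho> g ^^ n) (\<rho> v x)) \<longlonglongrightarrow> a + real j" if "\<bar>x - r\<bar> < e0" for x
    using basin_tendsto_shift[OF b, of "int j" "\<rho> v x"] e0(2)[OF that] by simp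
  have "\<forall>\<^sub>F n in sequentially. (\<rho> k' ^^ Suc j) ((\<rho> g ^^ n) (r - e)) < (\<rho> g ^^ n) (\<rho> v (r - e))"
  proof -
    have "(\<rho> k' ^^ Suc j) (a - 1) < a + real j"
      using Ka circle_lift_diff_1[OF K, of a] by simp
    then obtain t where t: "(\<rho> k' ^^ Suc j) (a - 1) < t" "t < a + real j" using dense by blast
    have "\<forall>\<^sub>F n in sequentially. (\<rho> k' ^^ Suc j) ((\<rho> g ^^ n) (r - e)) < t"
      by (rule order_tendstoD(2)[OF circle_lift_tendsto[OF K lim_left] t(1)])
    moreover have "\<forall>\<^sub>F n in sequentially. t < (\<rho> g ^^ n) (\<rho> v (r - e))"
      by (rule order_tendstoD(1)[OF lim_v t(2)]) (use e in auto)
    ultimately show ?thesis by eventually_elim simp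
  qed
  moreover have "\<forall>\<^sub>F n in sequentially. (\<rho> g ^^ n) (\<rho> v (r + e)) < y + real (Suc j)"
    by (rule order_tendstoD(2)[OF lim_v]) (use e y in auto)
  moreover have "\<forall>\<^sub>F n in sequentially. y < (\<rho> g ^^ n) (r + e)"
    by (rule order_tendstoD(1)[OF lim_right]) (use y in simp)
  ultimately have "\<forall>\<^sub>F n in sequentially.
      (\<rho> k' ^^ Suc j) ((\<rho> g ^^ n) (r - e)) < (\<rho> g ^^ n) (\<rho> v (r - e)) \<and>
      (\<rho> g ^^ n) (\<rho> v (r + e)) < y + real (Suc j) \<and> y < (\<rho> g ^^ n) (r + e)"
    by (intro eventually_conj)
  then obtain n where n: "(\<rho> k' ^^ Suc j) ((\<rho> g ^^ n) (r - e)) < (\<rho> g ^^ n) (\<rho> v (r - e))"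
      "(\<rho> g ^^ n) (\<rho> v (r + e)) < y + real (Suc j)" "y < (\<rho> g ^^ n) (r + e)"
    using eventually_happens'[OF sequentially_bot] by blast

  let ?gn = "g [^] n"
  have gn: "?gn \<in> carrier G" using g by simp
  define w where "w = ?gn \<otimes> v \<otimes> inv ?gn"
  have w: "w \<in> carrier G" using gn v w_def by simp
  have w_act: "\<rho> w (\<rho> ?gn x) = \<rho> ?gn (\<rho> v x)" for x
    using gn v by (simp add: w_def first.act_mult first.act_inv)
  show False
  proof (rule no_crossing)
    show "k' [^] Suc j \<in> carrier G" using k' by blast
    show "w \<in> carrier G" by (rule w)
    have "moves_up (\<sigma> k')"
      using second.moves_up_conj[OF k(1) _ k(2), of "inv c'"] c' unfolding k'_def by simp
    then show "moves_up (\<sigma> (k' [^] Suc j))"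
      using moves_up_funpow second.act_pow k' by metis
    have conj_down: "\<forall>x. \<sigma> (h \<otimes> t \<otimes> inv h) x < x"
      if "h \<in> carrier G" "t \<in> carrier G" "\<forall>x. \<sigma> t x < x" for h t
      using that by (metis second.act_mult second.act_less_inv_iff first.inv_closed first.m_closed)
    show "\<forall>x. \<sigma> w x < x"
      using conj_down[of "inv c" u] conj_down[of ?gn v] c u gn v u_down unfolding w_def v_def by simp
    show "\<rho> (k' [^] Suc j) (\<rho> ?gn (r - e)) \<le> \<rho> w (\<rho> ?gn (r - e))"
      using n(1) unfolding w_act unfolding first.act_pow[OF k'] first.act_pow[OF g] by simp
    have "\<rho> w y < \<rho> w (\<rho> ?gn (r + e))"
      using n(3) first.act_less_iff[OF w] first.act_pow[OF g] by simp
    then show "\<rho> w y \<le> \<rho> (k' [^] Suc j) y"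
      using n(2) Ky unfolding w_act unfolding first.act_pow[OF k'] first.act_pow[OF g] by linarith
  qed
next
  case False
  have int: "\<exists>i. \<rho> u x = x + of_int i" for x
  proof -
    let ?i = "\<lfloor>\<rho> u x - x\<rfloor>"
    have "x + of_int ?i \<le> \<rho> u x" "\<rho> u x < x + of_int ?i + 1" by linarith+
    then show ?thesis using False by (metis order_le_less)
  qed
  obtain i where i: "\<rho> u x0 = x0 + of_int i" using int by blast
  moreover have "x0 < \<rho> u x0" using u by (simp add: moves_up_def)
  ultimately have "0 < i" by simp
  then obtain j where j: "i = int (Suc j)" using zero_less_imp_eq_int by (metis gr0_implies_Suc)
  obtain m :: int where m: "x0 \<le> x1 + of_int m" "x1 + of_int m < x0 + 1"
    using ex_int_translate_into_unit_interval by blast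
  let ?y = "x1 + of_int m"
  obtain i' where i': "\<rho> u ?y = ?y + of_int i'" using int by blast
  have "\<rho> u x0 \<le> \<rho> u ?y" "\<rho> u ?y < \<rho> u x0 + 1"
    using first.act_le_iff[OF u(1)] first.act_less_iff[OF u(1)] first.act_add_1[OF u(1), of x0] m by metis+
  then have "real_of_int i - 1 < of_int i'" "of_int i' < real_of_int i + 1" using i i' m by linarith+
  then have "i' = i" by linarith
  have kl: "circle_lift (\<rho> k)" using first.act_lift k by blast
  have "?y + 1 \<le> \<rho> k ?y" using k(4) circle_lift_add_int[OF kl, of x1 m] by simp
  then have "?y + real (Suc j) \<le> (\<rho> k ^^ Suc j) ?y" by (rule funpow_ge_shift[OF kl])
  then have 1: "\<rho> u ?y \<le> \<rho> (k [^] Suc j) ?y"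
    unfolding first.act_pow[OF k(1)] using i' \<open>i' = i\<close> j by simp
  have "(\<rho> k ^^ Suc j) x0 < x0 + real (Suc j)" by (rule funpow_less_shift[OF kl k(3)])
  then have 2: "\<rho> (k [^] Suc j) x0 \<le> \<rho> u x0"
    unfolding first.act_pow[OF k(1)] using i j by simp
  have "moves_up (\<sigma> (k [^] Suc j))"
    unfolding second.act_pow[OF k(1)] by (rule moves_up_funpow[OF k(2)])
  then show False using no_crossing[OF _ _ u(1) u_down 2 1] k(1) by blast
qed

text \<open>Both directions follow from \<open>not_down_if_up\<close>, the converse by passing to inverses.\<close>

lemma moves_up_transfer:
  assumes g: "g \<in> carrier G" "basin (\<rho> g) r a"
    and k: "k \<in> carrier G" "moves_up (\<sigma> k)" "\<rho> k x0 < x0 + 1" "x1 + 1 \<le> \<rho> k x1"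
    and u: "u \<in> carrier G"
  shows "moves_up (\<rho> u) \<longleftrightarrow> moves_up (\<sigma> u)"
proof -
  have imp: "moves_up (\<sigma> h)" if h: "h \<in> carrier G" "moves_up (\<rho> h)" for h
  proof -
    have "\<nexists>x. \<sigma> h x = x" using same_fixing[OF h(1)] h(2) by (metis moves_up_def less_irrefl)
    then show ?thesis
      using moves_up_or_down[OF second.act_lift[OF h(1)]] not_down_if_up[OF g k h] by blast
  qed
  moreover have "moves_up (\<rho> u)" if up: "moves_up (\<sigma> u)"
  proof (rule ccontr)
    assume "\<not> moves_up (\<rho> u)"
    moreover have "\<nexists>x. \<rho> u x = x" using same_fixing[OF u] up by (metis moves_up_def less_irrefl)
    ultimately have "\<forall>x. \<rho> u x < x" using moves_up_or_down[OF first.act_lift[OF u]] by blast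
    then have "moves_up (\<rho> (inv u))" using u by (simp add: moves_up_def first.act_less_inv_iff)
    then have "moves_up (\<sigma> (inv u))" using imp u by simp
    then have "\<sigma> u 0 < 0" using u by (simp add: moves_up_def second.act_less_inv_iff)
    then show False using up by (metis moves_up_def less_asym)
  qed
  ultimately show ?thesis using u by blast
qed

end

section \<open>Extending an isomorphism of dense orbits\<close>

text \<open>The graph of the conjugacy: \<open>x\<close> and \<open>y\<close> determine corresponding cuts of the orbits of \<open>a\<close> and \<open>b\<close>.
  A relation is used instead of a supremum because it is symmetric in the two actions, so that the
  inverse map needs no separate construction.\<close>

definition orbit_cut ::
    "('g, 'm) monoid_scheme \<Rightarrow> ('g \<Rightarrow> real \<Rightarrow> real) \<Rightarrow> real \<Rightarrow> ('g \<Rightarrow> real \<Rightarrow> real) \<Rightarrow> real \<Rightarrow> real \<Rightarrow> real \<Rightarrow> bool"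
  where "orbit_cut G \<rho> a \<sigma> b x y \<longleftrightarrow>
    (\<forall>k\<in>carrier G. (\<rho> k a < x \<longrightarrow> \<sigma> k b \<le> y) \<and> (x < \<rho> k a \<longrightarrow> y \<le> \<sigma> k b))"

lemma orbit_cut_sym: "orbit_cut G \<rho> a \<sigma> b x y \<longleftrightarrow> orbit_cut G \<sigma> b \<rho> a y x"
  unfolding orbit_cut_def by (meson not_less)

text \<open>Existence is completeness of the line. For uniqueness, if \<open>y < z\<close> both corresponded to \<open>x\<close>, any
  two points of the orbit of \<open>b\<close> between them would have to come from the same point \<open>x\<close> of the
  orbit of \<open>a\<close>.\<close>

lemma ex1_orbit_cut:
  assumes "line_action G \<rho>" "line_action G \<sigma>"
    and less: "\<And>k l. k \<in> carrier G \<Longrightarrow> l \<in> carrier G \<Longrightarrow> \<rho> k a < \<rho> l a \<longleftrightarrow> \<sigma> k b < \<sigma> l b"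
  shows "\<exists>!y. orbit_cut G \<rho> a \<sigma> b x y"
proof (rule ex_ex1I)
  interpret first: line_action G \<rho> by fact
  interpret second: line_action G \<sigma> by fact
  let ?S = "{\<sigma> k b | k. k \<in> carrier G \<and> \<rho> k a < x}"
  obtain k0 where k0: "k0 \<in> carrier G" "\<rho> k0 a < x" using first.act_dense[of "x - 1" x] by auto
  have bound: "s \<le> \<sigma> l b" if "l \<in> carrier G" "x < \<rho> l a" "s \<in> ?S" for l s
  proof -
    obtain k where k: "s = \<sigma> k b" "k \<in> carrier G" "\<rho> k a < x" using \<open>s \<in> ?S\<close> by blast
    then show ?thesis using less[of k l] that by simp
  qed
  obtain l0 where l0: "l0 \<in> carrier G" "x < \<rho> l0 a" using first.act_dense[of x "x + 1"] by auto
  have "bdd_above ?S" using bound[OF l0] by (rule bdd_aboveI)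
  then have "\<sigma> k b \<le> Sup ?S" if "k \<in> carrier G" "\<rho> k a < x" for k
    using that by (intro cSup_upper) auto
  moreover have "Sup ?S \<le> \<sigma> l b" if "l \<in> carrier G" "x < \<rho> l a" for l
    using k0 bound[OF that] by (intro cSup_least) auto
  ultimately have "orbit_cut G \<rho> a \<sigma> b x (Sup ?S)" by (simp add: orbit_cut_def)
  then show "\<exists>y. orbit_cut G \<rho> a \<sigma> b x y" ..
next
  interpret second: line_action G \<sigma> by fact
  have False if y: "orbit_cut G \<rho> a \<sigma> b x y" and z: "orbit_cut G \<rho> a \<sigma> b x z" and "y < z" for y z
  proof -
    obtain k where k: "k \<in> carrier G" "y < \<sigma> k b" "\<sigma> k b < z" using second.act_dense[OF \<open>y < z\<close>] by blast
    obtain l where l: "l \<in> carrier G" "\<sigma> k b < \<sigma> l b" "\<sigma> l b < z" using second.act_dense[OF k(3)] by blast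
    have "\<not> x < \<rho> l a" using z l unfolding orbit_cut_def by (meson not_less)
    moreover have "\<not> \<rho> k a < x" using y k unfolding orbit_cut_def by (meson not_less)
    moreover have "\<rho> k a < \<rho> l a" using less k l by blast
    ultimately show False by linarith
  qed
  then show "y = z" if "orbit_cut G \<rho> a \<sigma> b x y" "orbit_cut G \<rho> a \<sigma> b x z" for y z
    using that by (metis linorder_neqE)
qed

lemma homeomorphism_if_mono_inverse:
  fixes f f' :: "real \<Rightarrow> real"
  assumes "mono f" "mono f'" "\<And>x. f' (f x) = x" "\<And>y. f (f' y) = y"
  shows "homeomorphism UNIV UNIV f f'"
proof -
  have "surj f" "surj f'" using assms(3,4) by (metis surjI)+
  then have "continuous_on UNIV f" "continuous_on UNIV f'"
    using assms(1,2) by (auto intro!: continuous_onI_mono simp: mono_def)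
  then show ?thesis using assms(3,4) by (intro homeomorphismI) auto
qed

text \<open>The map \<open>\<rho> k a \<mapsto> \<sigma> k b\<close> is an equivariant isomorphism of ordered sets between dense subsets of the
  line, so it extends to a homeomorphism. The extension is equivariant because the relation
  \<open>orbit_cut\<close> is invariant under the diagonal action of \<open>G\<close>.\<close>

lemma conjugate_if_orbits_order_isomorphic:
  assumes "line_action G \<rho>" "line_action G \<sigma>"
    and pos: "\<And>k. k \<in> carrier G \<Longrightarrow> a < \<rho> k a \<longleftrightarrow> b < \<sigma> k b"
  shows "\<exists>\<Theta> \<Theta>'. homeomorphism UNIV UNIV \<Theta> \<Theta>' \<and> (\<forall>g\<in>carrier G. \<forall>x. \<Theta> (\<rho> g x) = \<sigma> g (\<Theta> x))"
proof -
  interpret first: line_action G \<rho> by fact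
  interpret second: line_action G \<sigma> by fact
  have less: "\<rho> k a < \<rho> l a \<longleftrightarrow> \<sigma> k b < \<sigma> l b" if "k \<in> carrier G" "l \<in> carrier G" for k l
    using pos[of "inv\<^bsub>G\<^esub> k \<otimes>\<^bsub>G\<^esub> l"] that
    by (simp add: first.act_mult second.act_mult first.act_less_inv_iff second.act_less_inv_iff)
  let ?R = "orbit_cut G \<rho> a \<sigma> b"
  have ex1: "\<exists>!y. ?R x y" for x by (rule ex1_orbit_cut[OF assms(1,2) less])
  have ex1': "\<exists>!x. ?R x y" for y
    unfolding orbit_cut_sym[of G \<rho> a \<sigma> b] by (rule ex1_orbit_cut[OF assms(2,1)]) (simp add: less)
  define \<Theta> where "\<Theta> x = (THE y. ?R x y)" for x
  define \<Theta>' where "\<Theta>' y = (THE x. ?R x y)" for y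
  have R: "?R x y \<longleftrightarrow> y = \<Theta> x" for x y unfolding \<Theta>_def using theI'[OF ex1] ex1 by metis
  have R': "?R x y \<longleftrightarrow> x = \<Theta>' y" for x y unfolding \<Theta>'_def using theI'[OF ex1'] ex1' by metis
  have inv: "\<Theta>' (\<Theta> x) = x" "\<Theta> (\<Theta>' y) = y" for x y using R R' by metis+
  have "\<Theta> x \<le> \<Theta> z" if "x < z" for x z
  proof -
    obtain k where k: "k \<in> carrier G" "x < \<rho> k a" "\<rho> k a < z" using first.act_dense[OF \<open>x < z\<close>] by blast
    have "?R x (\<Theta> x)" "?R z (\<Theta> z)" using R by auto
    then have "\<Theta> x \<le> \<sigma> k b" "\<sigma> k b \<le> \<Theta> z" using k by (auto simp: orbit_cut_def)
    then show ?thesis by simp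
  qed
  then have "mono \<Theta>" by (metis monoI order_le_less order_refl)
  moreover have "mono \<Theta>'"
  proof (rule monoI)
    fix y z :: real
    assume "y \<le> z"
    then show "\<Theta>' y \<le> \<Theta>' z"
      using \<open>mono \<Theta>\<close> inv(2) by (metis linorder_le_cases monoD order_antisym order_refl)
  qed
  ultimately have "homeomorphism UNIV UNIV \<Theta> \<Theta>'"
    using inv by (intro homeomorphism_if_mono_inverse)
  moreover have "\<Theta> (\<rho> g x) = \<sigma> g (\<Theta> x)" if g: "g \<in> carrier G" for g x
  proof -
    have "?R (\<rho> g x) (\<sigma> g (\<Theta> x))"
      unfolding orbit_cut_def
    proof (intro ballI)
      fix k
      assume k: "k \<in> carrier G"
      let ?l = "inv\<^bsub>G\<^esub> g \<otimes>\<^bsub>G\<^esub> k"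
      have l: "?l \<in> carrier G" using g k by simp
      have "k = g \<otimes>\<^bsub>G\<^esub> ?l" using g k by (simp add: first.m_assoc[symmetric])
      then have kl: "\<rho> k a = \<rho> g (\<rho> ?l a)" "\<sigma> k b = \<sigma> g (\<sigma> ?l b)"
        using first.act_mult[OF g l] second.act_mult[OF g l] by simp_all
      have "?R x (\<Theta> x)" using R by simp
      then show "(\<rho> k a < \<rho> g x \<longrightarrow> \<sigma> k b \<le> \<sigma> g (\<Theta> x)) \<and> (\<rho> g x < \<rho> k a \<longrightarrow> \<sigma> g (\<Theta> x) \<le> \<sigma> k b)"
        unfolding kl first.act_less_iff[OF g] second.act_le_iff[OF g]
        using l unfolding orbit_cut_def by blast
    qed
    then show ?thesis using R by simp
  qed
  ultimately show ?thesis by blast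
qed

text \<open>By the criterion \<open>moves_attractor_right_iff\<close>, whose right-hand side means the same for both
  actions, the orbits of the attracting points \<open>a\<close> and \<open>a'\<close> of one element \<open>g\<close> are
  ordered alike.\<close>

lemma (in two_line_actions) conjugate_if_common_up:
  assumes g: "g \<in> carrier G" and b: "basin (\<rho> g) r a" and b': "basin (\<sigma> g) r' a'"
    and k: "k \<in> carrier G" "moves_up (\<sigma> k)" "\<rho> k x0 < x0 + 1" "x1 + 1 \<le> \<rho> k x1"
  shows "\<exists>\<Theta> \<Theta>'. homeomorphism UNIV UNIV \<Theta> \<Theta>' \<and> (\<forall>h\<in>carrier G. \<forall>x. \<Theta> (\<rho> h x) = \<sigma> h (\<Theta> x))"
proof (rule conjugate_if_orbits_order_isomorphic)
  show "line_action G \<rho>" "line_action G \<sigma>" by unfold_locales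
  show "a < \<rho> h a \<longleftrightarrow> a' < \<sigma> h a'" if h: "h \<in> carrier G" for h
    unfolding first.moves_attractor_right_iff[OF g b h] second.moves_attractor_right_iff[OF g b' h]
    using g h by (intro bex_cong refl arg_cong2[where f = eventually] ext)
      (simp add: same_fixing moves_up_transfer[OF g b k])
qed

section \<open>Hyperbolic-like actions\<close>

text \<open>A continuous injection is strictly monotone, and \<open>f (x + n) = f x + n\<close> rules out that it decreases.\<close>

lemma circle_lift_if_homeomorphism:
  assumes "homeomorphism UNIV UNIV f f'" and f: "commutes_with_int_translations f"
  shows "circle_lift f"
proof -
  have cont: "continuous_on UNIV f" using assms(1) by (simp add: homeomorphism_def)
  have inj: "inj f" using assms(1) by (metis UNIV_I homeomorphism_apply1 injI)
  have "f x < f y" if "x < y" for x y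
  proof -
    obtain n :: int where n: "y < x + of_int n" by (metis ex_less_of_int add.commute diff_less_eq)
    have "f (x + of_int n) = f x + of_int n"
      using f by (simp add: commutes_with_int_translations_def)
    then show ?thesis
      using continuous_inj_imp_mono[of x y "x + of_int n" f] that n
        continuous_on_subset[OF cont] inj_on_subset[OF inj] by fastforce
  qed
  then show ?thesis using cont f by (simp add: circle_lift_def strict_mono_def)
qed

lemma line_action_if_hyperbolic_like:
  assumes "group G" and hyp: "hyperbolic_like G \<rho>" and min: "minimal_action G \<rho>"
  shows "line_action G \<rho>"
proof -
  interpret group G by fact
  have act: "group_action G UNIV \<rho>" using hyp by (simp add: hyperbolic_like_def acts_by_homeos_on_line_def)
  show ?thesis
  proof
    show "\<rho> (g \<otimes>\<^bsub>G\<^esub> h) x = \<rho> g (\<rho> h x)" if "g \<in> carrier G" "h \<in> carrier G" for g h x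
      using group_action.composition_rule[OF act UNIV_I that] .
    show "\<rho> \<one>\<^bsub>G\<^esub> x = x" for x
      using group_action.id_eq_one[OF act] by (metis UNIV_I restrict_apply')
    show "circle_lift (\<rho> g)" if "g \<in> carrier G" for g
      using circle_lift_if_homeomorphism hyp that
      unfolding hyperbolic_like_def acts_by_homeos_on_line_def by blast
    show "\<exists>g\<in>carrier G. c < \<rho> g x \<and> \<rho> g x < d" if "c < d" for c d x
    proof -
      have "(c + d) / 2 \<in> closure (orbit G \<rho> x)" using min by (simp add: minimal_action_def)
      moreover have "open {c<..<d}" "(c + d) / 2 \<in> {c<..<d}" using that by auto
      ultimately have "orbit G \<rho> x \<inter> {c<..<d} \<noteq> {}" using closure_iff_nhds_not_empty by (metis order_refl)
      then show ?thesis by (auto simp: orbit_def)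
    qed
  qed
qed

text \<open>The two fixed points in \<open>[0, 1)\<close> may come in either order; the repelling one is translated by \<open>-1\<close>
  if needed, so that it is the one just to the left of \<open>a\<close>.\<close>

lemma ex_basin_if_hyperbolic_like:
  assumes "line_action G \<rho>" and hyp: "hyperbolic_like G \<rho>"
    and g: "g \<in> carrier G" "g \<noteq> \<one>\<^bsub>G\<^esub>" and fixed: "\<exists>x. \<rho> g x = x"
  shows "\<exists>r a. basin (\<rho> g) r a"
proof -
  interpret line_action G \<rho> by fact
  let ?f = "\<rho> g"
  obtain a r where ar: "a \<noteq> r" and fixed_pair: "{x \<in> {0..<1}. ?f x = x} = {a, r}"
    and att: "attracting_fixpoint ?f a"
    using hyp g fixed unfolding hyperbolic_like_def by blast
  have a: "0 \<le> a" "a < 1" and r: "0 \<le> r" "r < 1" "?f r = r" using fixed_pair by auto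
  have in_pair: "x = a \<or> x = r" if "0 \<le> x" "x < 1" "?f x = x" for x using fixed_pair that by auto
  have lift: "circle_lift ?f" by (rule act_lift[OF g(1)])
  define r' where "r' = (if r < a then r else r - 1)"
  have "?f r' = r'" using r circle_lift_diff_1[OF lift, of r] by (simp add: r'_def)
  moreover have "r' < a" "a < r' + 1" using a r ar by (auto simp: r'_def)
  moreover have "x = a" if x: "r' < x" "x < r' + 1" "?f x = x" for x
  proof -
    consider "x < 0" | "0 \<le> x" "x < 1" | "1 \<le> x" by linarith
    then show ?thesis
    proof cases
      case 1
      then show ?thesis
        using in_pair[of "x + 1"] circle_lift_add_1[OF lift, of x] x a r ar
        by (auto simp: r'_def split: if_splits)
    next
      case 2
      then show ?thesis using in_pair[of x] x by (auto simp: r'_def split: if_splits)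
    next
      case 3
      then show ?thesis
        using in_pair[of "x - 1"] circle_lift_diff_1[OF lift, of x] x a r ar
        by (auto simp: r'_def split: if_splits)
    qed
  qed
  ultimately show ?thesis using basin_if_attracting[OF lift _ _ _ att] by blast
qed

theorem theorem1p1:
  fixes G :: "('g, 'm) monoid_scheme"
    and \<rho>1 \<rho>2 :: "'g \<Rightarrow> real \<Rightarrow> real"
  assumes "group G"
    and "\<not> comm_group G"
    and "acts_by_homeos_on_line G \<rho>1" and "acts_by_homeos_on_line G \<rho>2"
    and "minimal_action G \<rho>1" and "minimal_action G \<rho>2"
    and "hyperbolic_like G \<rho>1" and "hyperbolic_like G \<rho>2"
    and "\<And>g. g \<in> carrier G \<Longrightarrow> (\<exists>x. \<rho>1 g x = x) \<longleftrightarrow> (\<exists>x. \<rho>2 g x = x)"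
  shows "\<exists>\<Theta> \<Theta>'. homeomorphism UNIV UNIV \<Theta> \<Theta>' \<and>
           (\<forall>g\<in>carrier G. \<Theta> \<circ> \<rho>1 g = \<rho>2 g \<circ> \<Theta>)"
proof -
  interpret first: line_action G \<rho>1 using assms by (intro line_action_if_hyperbolic_like)
  interpret second: line_action G \<rho>2 using assms by (intro line_action_if_hyperbolic_like)
  obtain g where g: "g \<in> carrier G" "g \<noteq> \<one>\<^bsub>G\<^esub>" "\<exists>x. \<rho>1 g x = x"
    using first.free_imp_comm_group assms(2) by blast
  obtain r a where b1: "basin (\<rho>1 g) r a"
    using ex_basin_if_hyperbolic_like[OF first.line_action_axioms assms(7) g] by blast
  obtain r' a' where b2: "basin (\<rho>2 g) r' a'"
    using ex_basin_if_hyperbolic_like[OF second.line_action_axioms assms(8) g(1,2)] assms(9) g by blast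
  obtain k x0 x1 where k: "k \<in> carrier G" "moves_up (\<rho>1 k)" "\<rho>1 k x0 < x0 + 1" "x1 + 1 \<le> \<rho>1 k x1"
    using first.ex_moves_up_crossing_translation[OF g(1) b1] by blast
  have "\<nexists>x. \<rho>2 k x = x" using assms(9)[OF k(1)] k(2) by (metis moves_up_def less_irrefl)
  then consider "moves_up (\<rho>2 k)" | "\<forall>x. \<rho>2 k x < x"
    using moves_up_or_down[OF second.act_lift[OF k(1)]] by blast
  then show ?thesis
  proof cases
    case 1
    interpret two_line_actions G \<rho>1 \<rho>2 by unfold_locales (rule assms(9))
    show ?thesis
      using conjugate_if_common_up[OF g(1) b1 b2 k(1) 1 k(3,4)] by (simp add: fun_eq_iff)
  next
    case 2
    \<comment> \<open>The desired homeomorphism reverses orientation, so the second action is first reflected.\<close>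
    let ?\<sigma> = "\<lambda>g x. - \<rho>2 g (- x)"
    interpret reflected: line_action G ?\<sigma> by (rule second.line_action_reflect)
    have "(\<exists>x. \<rho>1 h x = x) \<longleftrightarrow> (\<exists>x. ?\<sigma> h x = x)" if "h \<in> carrier G" for h
      unfolding assms(9)[OF that] by (metis minus_minus)
    then interpret two_line_actions G \<rho>1 ?\<sigma> by unfold_locales
    have "x < - \<rho>2 k (- x)" for x using 2[rule_format, of "- x"] by simp
    then have "moves_up (?\<sigma> k)" by (simp add: moves_up_def)
    then obtain \<Theta> \<Theta>' where hom: "homeomorphism UNIV UNIV \<Theta> \<Theta>'"
      and conj: "\<forall>h\<in>carrier G. \<forall>x. \<Theta> (\<rho>1 h x) = - \<rho>2 h (- \<Theta> x)"
      using conjugate_if_common_up[OF g(1) b1 basin_reflect[OF b2] k(1) _ k(3,4)] by blast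
    have "homeomorphism UNIV UNIV (uminus :: real \<Rightarrow> real) uminus"
      by (intro homeomorphismI continuous_intros) auto
    from homeomorphism_compose[OF hom this]
    have "homeomorphism UNIV UNIV (uminus \<circ> \<Theta>) (\<Theta>' \<circ> uminus)" .
    moreover have "\<forall>h\<in>carrier G. (uminus \<circ> \<Theta>) \<circ> \<rho>1 h = \<rho>2 h \<circ> (uminus \<circ> \<Theta>)"
      using conj by (simp add: fun_eq_iff)
    ultimately show ?thesis by blast
  qed
qed

end
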